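(* Given the set of conserved variables $(\varrho,\varrho v,\varrho E)$, a numerical flux $(f^{\mathrm{num}}_\varrho,f^{\mathrm{num}}_{\varrho v},f^{\mathrm{num}}_{\varrho E})$, source terms $S^{\varrho v}$, $S^{\varrho E}$ and the corresponding finite volume method with gravity are total energy-conservative (TEC, including the potential energy) if the density flux and the source terms are of the form $$f^{\mathrm{num}}_\varrho=\overline\varrho\,\{\!\{v\}\!\},\qquad S^{\varrho v}=\overline\varrho\,[\![\phi]\!],\qquad S^{\varrho E}=f^{\mathrm{num}}_\varrho\,[\![\phi]\!].$$
   Context: The equations are $\partial_t\varrho+\partial_x(\varrho v)=0$, $\partial_t(\varrho v)+\partial_x(\varrho v^2+p)=-\varrho\,\partial_x\phi$, $\partial_t(\varrho E)+\partial_x((\varrho E+p)v)=-\varrho v\,\partial_x\phi$, where $\varrho E=\frac p{\gamma-1}+\frac12\varrho v^2$ is the sum of internal and kinetic energy, $\gamma>1$, and $\phi=\phi(x)$ is a time-independent geopotential. At the interface $i+\frac12$ between cells $i$ and $i+1$: $[\![a]\!]_{i+1/2}=a_{i+1}-a_i$, $\{\!\{a\}\!\}_{i+1/2}=(a_{i+1}+a_i)/2$; $\overline\varrho_{i+1/2}$ is any consistent mean value of the density, i.e. a two-point function of the adjacent states with $\overline\varrho_{i+1/2}=\varrho$ whenever $\varrho_i=\varrho_{i+1}=\varrho$. Numerical fluxes are two-point functions consistent with the exact flux (equal to it for equal states). The finite volume method is $$\partial_tu_i+\frac1{\Delta x}(f_{i+1/2}-f_{i-1/2})=-\mathcal S_i,\quad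 f_{i+1/2}=f^{\mathrm{num}}(u_i,u_{i+1}),\quad\mathcal S_i=(0,\mathcal S_i^{\varrho v},\mathcal S_i^{\varrho E}),$$ with $\mathcal S_i^{\varrho v}=\frac{S^{\varrho v}_{i+1/2}+S^{\varrho v}_{i-1/2}}{2\Delta x}$ and $\mathcal S_i^{\varrho E}=\frac{S^{\varrho E}_{i+1/2}+S^{\varrho E}_{i-1/2}}{2\Delta x}$. The method is TEC if $U=\varrho E+\varrho\phi$ satisfies a semi-discrete conservation law $\frac{dU_i}{dt}=-\frac1{\Delta x}(H_{i+1/2}-H_{i-1/2})$ for all $i$, where $H_{i+1/2}$ is a two-point function of $(u_i,\phi_i)$ and $(u_{i+1},\phi_{i+1})$, consistent with the total energy flux $(\varrho E+p+\varrho\phi)v$. *)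

theory Defs
  imports "HOL-Analysis.Analysis"
begin

text \<open>
  Conserved variables \<open>(\<rho>, \<rho>v, \<rho>E)\<close>. The third component is the sum of internal and kinetic
  energy per volume and does not contain the potential energy.
\<close>

type_synonym state = "real \<times> real \<times> real"

definition density :: "state \<Rightarrow> real" where
  "density u = fst u"

definition momentum :: "state \<Rightarrow> real" where
  "momentum u = fst (snd u)"

definition energy :: "state \<Rightarrow> real" where
  "energy u = snd (snd u)"

definition velocity :: "state \<Rightarrow> real" where
  "velocity u = momentum u / density u"

text \<open>The equation of state \<open>\<rho>E = p / (\<gamma> - 1) + \<rho>v\<^sup>2 / 2\<close>, solved for \<open>p\<close>.\<close>

definition pressure :: "real \<Rightarrow> state \<Rightarrow> real" where
  "pressure \<gamma> u = (\<gamma> - 1) * (energy u - density u * (velocity u)\<^sup>2 / 2)"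

text \<open>
  Two-point functions such as numerical fluxes and mean values are total in HOL; everything
  below constrains them on admissible states only.
\<close>

definition admissible :: "real \<Rightarrow> state \<Rightarrow> bool" where
  "admissible \<gamma> u \<longleftrightarrow> density u > 0 \<and> pressure \<gamma> u > 0"

definition euler_flux :: "real \<Rightarrow> state \<Rightarrow> state" where
  "euler_flux \<gamma> u =
     (density u * velocity u,
      density u * (velocity u)\<^sup>2 + pressure \<gamma> u,
      (energy u + pressure \<gamma> u) * velocity u)"

definition consistent_flux :: "real \<Rightarrow> (state \<Rightarrow> state \<Rightarrow> state) \<Rightarrow> bool" where
  "consistent_flux \<gamma> f \<longleftrightarrow> (\<forall>u. admissible \<gamma> u \<longrightarrow> f u u = euler_flux \<gamma> u)"

text \<open>A density mean may depend on the full states, but only equality of the densities is required.\<close>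

definition consistent_density_mean :: "real \<Rightarrow> (state \<Rightarrow> state \<Rightarrow> real) \<Rightarrow> bool" where
  "consistent_density_mean \<gamma> m \<longleftrightarrow>
     (\<forall>ul ur. admissible \<gamma> ul \<longrightarrow> admissible \<gamma> ur \<longrightarrow> density ul = density ur \<longrightarrow>
        m ul ur = density ul)"

definition jump :: "real \<Rightarrow> real \<Rightarrow> real" where
  "jump al ar = ar - al"

definition avg :: "real \<Rightarrow> real \<Rightarrow> real" where
  "avg al ar = (ar + al) / 2"

text \<open>Real-valued two-point functions of a state and a value of the geopotential in each cell.\<close>

type_synonym two_point = "state \<times> real \<Rightarrow> state \<times> real \<Rightarrow> real"

text \<open>
  The grid is uniform with cells indexed by the integers; the value of a quantity at the
  interface \<open>i + 1/2\<close> is obtained from the cells \<open>i\<close> and \<open>i + 1\<close>.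
\<close>

definition source_average :: "real \<Rightarrow> two_point \<Rightarrow> (int \<Rightarrow> state) \<Rightarrow> (int \<Rightarrow> real) \<Rightarrow> int \<Rightarrow> real" where
  "source_average \<Delta>x S u \<phi> i =
     (S (u i, \<phi> i) (u (i + 1), \<phi> (i + 1)) + S (u (i - 1), \<phi> (i - 1)) (u i, \<phi> i)) / (2 * \<Delta>x)"

definition fv_solution ::
  "real \<Rightarrow> (state \<Rightarrow> state \<Rightarrow> state) \<Rightarrow> two_point \<Rightarrow> two_point \<Rightarrow> real \<Rightarrow> (int \<Rightarrow> real) \<Rightarrow>
     real set \<Rightarrow> (real \<Rightarrow> int \<Rightarrow> state) \<Rightarrow> bool" where
  "fv_solution \<gamma> f Smom Sen \<Delta>x \<phi> I u \<longleftrightarrow>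
     (\<forall>t\<in>I. \<forall>i. admissible \<gamma> (u t i) \<and>
        ((\<lambda>s. u s i) has_vector_derivative
           - (1 / \<Delta>x) *\<^sub>R (f (u t i) (u t (i + 1)) - f (u t (i - 1)) (u t i))
           - (0, source_average \<Delta>x Smom (u t) \<phi> i, source_average \<Delta>x Sen (u t) \<phi> i))
         (at t within I))"

definition total_energy :: "state \<Rightarrow> real \<Rightarrow> real" where
  "total_energy u \<phi> = energy u + density u * \<phi>"

definition consistent_total_energy_flux :: "real \<Rightarrow> two_point \<Rightarrow> bool" where
  "consistent_total_energy_flux \<gamma> H \<longleftrightarrow>
     (\<forall>u \<phi>. admissible \<gamma> u \<longrightarrow>
        H (u, \<phi>) (u, \<phi>) = (energy u + pressure \<gamma> u + density u * \<phi>) * velocity u)"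

text \<open>
  The total energy flux is chosen before the mesh width, the geopotential and the solution, so
  that it depends on nothing but the data of the two cells at an interface. The cell values of
  the geopotential are an arbitrary sequence; they do not depend on time.
\<close>

definition total_energy_conservative ::
  "real \<Rightarrow> (state \<Rightarrow> state \<Rightarrow> state) \<Rightarrow> two_point \<Rightarrow> two_point \<Rightarrow> bool" where
  "total_energy_conservative \<gamma> f Smom Sen \<longleftrightarrow>
     (\<exists>H. consistent_total_energy_flux \<gamma> H \<and>
        (\<forall>\<Delta>x \<phi> I u. \<Delta>x > 0 \<longrightarrow> is_interval I \<longrightarrow> fv_solution \<gamma> f Smom Sen \<Delta>x \<phi> I u \<longrightarrow>
           (\<forall>t\<in>I. \<forall>i.
              ((\<lambda>s. total_energy (u s i) (\<phi> i)) has_real_derivative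
                 - (1 / \<Delta>x) * (H (u t i, \<phi> i) (u t (i + 1), \<phi> (i + 1))
                              - H (u t (i - 1), \<phi> (i - 1)) (u t i, \<phi> i)))
               (at t within I))))"

end

theory Submission
  imports Defs
begin

text \<open>
  The potential energy \<open>\<rho>\<phi>\<close> in a cell changes through the density flux alone, because \<open>\<phi>\<close> does not
  depend on time. With \<open>F\<close> for the density flux and \<open>\<pm>\<close> for the interfaces \<open>i \<plusminus> 1/2\<close>, the gravity
  terms in the balance of \<open>\<rho>E + \<rho>\<phi>\<close> in cell \<open>i\<close>, multiplied by \<open>-\<Delta>x\<close>, are
  \<open>(F\<^sub>+ - F\<^sub>-) \<phi>\<^sub>i + (F\<^sub>+ (\<phi>\<^sub>i\<^sub>+\<^sub>1 - \<phi>\<^sub>i) + F\<^sub>- (\<phi>\<^sub>i - \<phi>\<^sub>i\<^sub>-\<^sub>1)) / 2\<close>. Half the jump of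
  \<open>\<phi>\<close> is, up to the sign, the difference between its average at the interface and its value in the
  cell. The terms with \<open>\<phi>\<^sub>i\<close> cancel, and the sum is the interface difference of \<open>F\<close> times the
  average of \<open>\<phi>\<close>. Total energy is therefore conserved with the
  flux \<open>f\<^sub>\<rho>\<^sub>E + f\<^sub>\<rho> {{\<phi>}}\<close>, which is consistent because the numerical flux is.
\<close>

text \<open>
  The numerical flux of total energy: the flux of internal and kinetic energy, plus potential
  energy transported by the density flux. The functions \<^const>\<open>density\<close> and \<^const>\<open>energy\<close> are used
  here as projections of the numerical flux vector.
\<close>

definition numerical_total_energy_flux :: "(state \<Rightarrow> state \<Rightarrow> state) \<Rightarrow> two_point" where
  "numerical_total_energy_flux f a b =
     energy (f (fst a) (fst b)) + density (f (fst a) (fst b)) * avg (snd a) (snd b)"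

lemma consistent_numerical_total_energy_flux:
  assumes "consistent_flux \<gamma> f"
  shows "consistent_total_energy_flux \<gamma> (numerical_total_energy_flux f)"
  using assms
  by (auto simp: consistent_total_energy_flux_def consistent_flux_def
      numerical_total_energy_flux_def euler_flux_def density_def energy_def avg_def algebra_simps)

lemma total_energy_has_real_derivative:
  assumes "(U has_vector_derivative D) (at t within I)"
  shows "((\<lambda>s. total_energy (U s) c) has_real_derivative total_energy D c) (at t within I)"
proof -
  have "bounded_linear (\<lambda>u. total_energy u c)"
    unfolding total_energy_def energy_def density_def
    by (intro bounded_linear_add bounded_linear_mult_left[THEN bounded_linear_compose]
        bounded_linear_snd[THEN bounded_linear_compose] bounded_linear_fst bounded_linear_snd)
  from bounded_linear.has_vector_derivative[OF this assms] show ?thesis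
    by (simp add: has_real_derivative_iff_has_vector_derivative)
qed

text \<open>
  The discrete product rule behind the theorem: the finite volume update of the state in cell \<open>i\<close>,
  contracted with \<open>(\<phi>\<^sub>i, 0, 1)\<close>, is a difference of two-point fluxes. The momentum source \<open>m\<close> is
  arbitrary.
\<close>

lemma total_energy_fv_update:
  assumes "Sen (u i, \<phi> i) (u (i + 1), \<phi> (i + 1)) =
             density (f (u i) (u (i + 1))) * jump (\<phi> i) (\<phi> (i + 1))"
    and "Sen (u (i - 1), \<phi> (i - 1)) (u i, \<phi> i) =
             density (f (u (i - 1)) (u i)) * jump (\<phi> (i - 1)) (\<phi> i)"
  shows "total_energy (- (1 / \<Delta>x) *\<^sub>R (f (u i) (u (i + 1)) - f (u (i - 1)) (u i))
             - (0, m, source_average \<Delta>x Sen u \<phi> i)) (\<phi> i) =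
           - (1 / \<Delta>x) * (numerical_total_energy_flux f (u i, \<phi> i) (u (i + 1), \<phi> (i + 1))
                        - numerical_total_energy_flux f (u (i - 1), \<phi> (i - 1)) (u i, \<phi> i))"
  unfolding source_average_def assms
  by (simp add: total_energy_def numerical_total_energy_flux_def density_def energy_def
      jump_def avg_def field_split_simps)

lemma total_energy_conservative_of_energy_source:
  assumes "consistent_flux \<gamma> f"
    and Sen: "\<And>ul ur \<phi>l \<phi>r. admissible \<gamma> ul \<Longrightarrow> admissible \<gamma> ur \<Longrightarrow>
           Sen (ul, \<phi>l) (ur, \<phi>r) = density (f ul ur) * jump \<phi>l \<phi>r"
  shows "total_energy_conservative \<gamma> f Smom Sen"
  unfolding total_energy_conservative_def
proof (intro exI[of _ "numerical_total_energy_flux f"] conjI allI impI ballI)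
  show "consistent_total_energy_flux \<gamma> (numerical_total_energy_flux f)"
    using assms(1) by (rule consistent_numerical_total_energy_flux)
next
  fix \<Delta>x :: real and \<phi> :: "int \<Rightarrow> real" and I u t i
  assume sol: "fv_solution \<gamma> f Smom Sen \<Delta>x \<phi> I u" and t: "t \<in> I"
  have adm: "admissible \<gamma> (u t j)" for j
    using sol t by (simp add: fv_solution_def)
  have "((\<lambda>s. u s i) has_vector_derivative
           - (1 / \<Delta>x) *\<^sub>R (f (u t i) (u t (i + 1)) - f (u t (i - 1)) (u t i))
           - (0, source_average \<Delta>x Smom (u t) \<phi> i, source_average \<Delta>x Sen (u t) \<phi> i))
         (at t within I)"
    using sol t unfolding fv_solution_def by blast
  from total_energy_has_real_derivative[OF this, of "\<phi> i"]
  show "((\<lambda>s. total_energy (u s i) (\<phi> i)) has_real_derivative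
           - (1 / \<Delta>x) * (numerical_total_energy_flux f (u t i, \<phi> i) (u t (i + 1), \<phi> (i + 1))
                        - numerical_total_energy_flux f (u t (i - 1), \<phi> (i - 1)) (u t i, \<phi> i)))
         (at t within I)"
    by (simp only: total_energy_fv_update Sen adm)
qed

theorem lemma4p2:
  fixes \<gamma> :: real
    and fnum :: "state \<Rightarrow> state \<Rightarrow> state"
    and Smom Sen :: two_point
    and rho_mean :: "state \<Rightarrow> state \<Rightarrow> real"
  assumes "\<gamma> > 1"
    and "consistent_flux \<gamma> fnum"
    and "consistent_density_mean \<gamma> rho_mean"
    and "\<And>ul ur. admissible \<gamma> ul \<Longrightarrow> admissible \<gamma> ur \<Longrightarrow>
           fst (fnum ul ur) = rho_mean ul ur * avg (velocity ul) (velocity ur)"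
    and "\<And>ul ur \<phi>l \<phi>r. admissible \<gamma> ul \<Longrightarrow> admissible \<gamma> ur \<Longrightarrow>
           Smom (ul, \<phi>l) (ur, \<phi>r) = rho_mean ul ur * jump \<phi>l \<phi>r"
    and "\<And>ul ur \<phi>l \<phi>r. admissible \<gamma> ul \<Longrightarrow> admissible \<gamma> ur \<Longrightarrow>
           Sen (ul, \<phi>l) (ur, \<phi>r) = fst (fnum ul ur) * jump \<phi>l \<phi>r"
  shows "total_energy_conservative \<gamma> fnum Smom Sen"
  using assms(2,6)
  by (intro total_energy_conservative_of_energy_source) (simp_all add: density_def)

end
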